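(* Let $(Y^1_i,Z^1_i)_{0\le i\le n}$ be the solution of the scheme $\mathcal E[(F^1_i),\xi^1]$ and $(Y^2_i,Z^2_i)_{0\le i\le n}$ the solution of the scheme $\mathcal E[(F^2_i),\xi^2]$ (same grid and same coefficients $H_i$; see context). Assume that $F^1$ satisfies: (i) each $F^1_i:\Omega\times\mathbb R\times\mathbb R^{1\times d}\to\mathbb R$ is $\mathcal F_{t_i}\otimes\mathcal B(\mathbb R)\otimes\mathcal B(\mathbb R^{1\times d})$-measurable, $F^1_i(0,0)\in L^2(\mathcal F_{t_i})$, and $|F^1_i(y,z)-F^1_i(y',z')|\le K_y|y-y'|+K^n_z|z-z'|$ for all $y,y',z,z'$, where the positive constants $K_y$, $K_z^n$ do not depend on $i$ ($K_y$ does not depend on $n$, $K^n_z$ may depend on $n$); (ii) $hK_y<1-\varepsilon$ for a given $\varepsilon\in(0,1)$ not depending on $n$; (iii) $\big(\sup_{0\le i\le n-1}h_i|H_i|\big)K^n_z<1$. If $$Y^1_n\ge Y^2_n\quad\text{and}\quad F^1_i(Y^2_i,Z^2_i)\ge F^2_i(Y^2_i,Z^2_i),\quad 0\le i\le n-1,$$ then $Y^1_i\ge Y^2_i$ for all $0\le i\le n$.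
   Context: $(\mathcal F_t)_{0\le t\le T}$ is the Brownian filtration on $(\Omega,\mathcal A,\mathbb P)$ of a $d$-dimensional Brownian motion, $\mathbb E_t[\cdot]=\mathbb E[\cdot|\mathcal F_t]$. The grid is $0=t_0<\dots<t_n=T$, $h_i=t_{i+1}-t_i$, $h=\max_ih_i$. The coefficients $(H_i)_{0\le i<n}$ are independent $\mathbb R^{1\times d}$-valued random vectors such that $H_i$ is $\mathcal F_{t_{i+1}}$-measurable, $\mathbb E_{t_i}[H_i]=0$, and $c_iI_{d\times d}=h_i\mathbb E[H_i^\top H_i]=h_i\mathbb E_{t_i}[H_i^\top H_i]$ with $\lambda/d\le c_i\le\Lambda/d$ for positive constants $\lambda,\Lambda$. The scheme $\mathcal E[(F_i),\xi]$, with $\xi\in L^2(\mathcal F_T)$, has solution $(Y_i,Z_i)_{0\le i\le n}$ (adapted to $(\mathcal F_{t_i})$, square integrable) defined by $Y_n=\xi$, $Z_n=0$ and for $0\le i<n$ $$Y_i=\mathbb E_{t_i}[Y_{i+1}+h_iF_i(Y_i,Z_i)],\qquad Z_i=\mathbb E_{t_i}[Y_{i+1}H_i].$$ Inequalities between random variables hold almost surely. *)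

theory Defs
  imports "HOL-Probability.Probability"
begin

text \<open>
  Row vectors in $R^{1 \times d}$ are elements of \<^typ>\<open>real^'d\<close>, where $d$ is the cardinality of
  the arbitrary finite index type. The norm on \<^typ>\<open>real^'d\<close> is the Euclidean one.
\<close>

definition outer_product :: "real^'d \<Rightarrow> real^'d \<Rightarrow> real^'d^'d" where
  "outer_product u v = (\<chi> k l. u $ k * v $ l)"

lemma outer_product_eq_transpose_matrix_mult:
  "outer_product u v = transpose (rowvector u :: real^'d^1) ** (rowvector v :: real^'d^1)"
  by (simp add: outer_product_def transpose_def rowvector_def matrix_matrix_mult_def)


subsection \<open>Brownian motion and its filtration\<close>

definition brownian_motion :: "'a measure \<Rightarrow> real \<Rightarrow> (real \<Rightarrow> 'a \<Rightarrow> real^'d) \<Rightarrow> bool" where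
  "brownian_motion M T W \<longleftrightarrow>
     prob_space M \<and>
     (\<forall>s\<in>{0..T}. W s \<in> borel_measurable M) \<and>
     (AE \<omega> in M. W 0 \<omega> = 0) \<and>
     (AE \<omega> in M. continuous_on {0..T} (\<lambda>s. W s \<omega>)) \<and>
     (\<forall>(m::nat) u. (\<forall>j\<le>m. u j \<in> {0..T}) \<longrightarrow> (\<forall>j<m. u j < u (Suc j)) \<longrightarrow>
        prob_space.indep_vars M (\<lambda>_. borel) (\<lambda>j \<omega>. W (u (Suc j)) \<omega> - W (u j) \<omega>) {..<m}) \<and>
     \<comment> \<open>increments are centred Gaussian with covariance matrix $(r - s) I$\<close>
     (\<forall>s\<in>{0..T}. \<forall>r\<in>{0..T}. s < r \<longrightarrow>
        prob_space.indep_vars M (\<lambda>_. borel) (\<lambda>k \<omega>. (W r \<omega> - W s \<omega>) $ k) UNIV \<and>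
        (\<forall>k. distributed M lborel (\<lambda>\<omega>. (W r \<omega> - W s \<omega>) $ k) (normal_density 0 (sqrt (r - s)))))"

text \<open>
  The filtration generated by \<open>W\<close>, augmented as usual by the null sets of \<open>M\<close>.
\<close>

definition brownian_filtration ::
    "'a measure \<Rightarrow> (real \<Rightarrow> 'a \<Rightarrow> real^'d) \<Rightarrow> real \<Rightarrow> 'a measure" where
  "brownian_filtration M W s =
     sigma (space M)
       ({W r -` A \<inter> space M | r A. r \<in> {0..s} \<and> A \<in> sets borel} \<union> null_sets M)"

lemma space_brownian_filtration [simp]: "space (brownian_filtration M W s) = space M"
  unfolding brownian_filtration_def by (rule space_measure_of) (auto dest: sets.sets_into_space)

lemma subalgebra_brownian_filtration:
  assumes "brownian_motion M T W" and "s \<le> T"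
  shows "subalgebra M (brownian_filtration M W s)"
proof -
  have "{W r -` A \<inter> space M | r A. r \<in> {0..s} \<and> A \<in> sets borel} \<union> null_sets M \<subseteq> sets M"
    using assms by (auto simp: brownian_motion_def intro!: measurable_sets[where A = borel])
  then have "sets (brownian_filtration M W s) \<subseteq> sets M"
    unfolding brownian_filtration_def
    by (subst sets_measure_of)
      (simp_all only: sets.sigma_sets_subset order_trans[OF _ sets.space_closed])
  then show ?thesis
    by (simp add: subalgebra_def)
qed


subsection \<open>Square integrability and conditional expectation\<close>

definition L2 :: "'a measure \<Rightarrow> 'a measure \<Rightarrow> ('a \<Rightarrow> 'b::euclidean_space) set" where
  "L2 M F = {X. X \<in> borel_measurable F \<and> integrable M (\<lambda>\<omega>. (norm (X \<omega>))\<^sup>2)}"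

text \<open>
  Conditional expectation of a vector- or matrix-valued random variable, taken coordinatewise;
  on \<^typ>\<open>real\<close> it is \<^const>\<open>real_cond_exp\<close>.
\<close>

definition cond_exp :: "'a measure \<Rightarrow> 'a measure \<Rightarrow> ('a \<Rightarrow> 'b::euclidean_space) \<Rightarrow> 'a \<Rightarrow> 'b" where
  "cond_exp M F X = (\<lambda>\<omega>. \<Sum>b\<in>Basis. real_cond_exp M F (\<lambda>\<omega>'. X \<omega>' \<bullet> b) \<omega> *\<^sub>R b)"

lemma cond_exp_real: "cond_exp M F (X :: 'a \<Rightarrow> real) = real_cond_exp M F X"
  by (simp add: cond_exp_def)

lemma cond_exp_nth: "cond_exp M F X \<omega> $ k = real_cond_exp M F (\<lambda>\<omega>'. X \<omega>' $ k) \<omega>"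
  for X :: "'a \<Rightarrow> real^'d"
proof -
  have "cond_exp M F X \<omega> $ k = cond_exp M F X \<omega> \<bullet> axis k 1"
    by (simp add: inner_axis)
  also have "\<dots> = real_cond_exp M F (\<lambda>\<omega>'. X \<omega>' \<bullet> axis k 1) \<omega>"
    unfolding cond_exp_def by (rule inner_sum_left_Basis) (simp add: axis_in_Basis_iff)
  finally show ?thesis
    by (simp add: inner_axis)
qed


subsection \<open>The scheme\<close>

definition time_grid :: "real \<Rightarrow> nat \<Rightarrow> (nat \<Rightarrow> real) \<Rightarrow> bool" where
  "time_grid T n t \<longleftrightarrow> 0 < n \<and> t 0 = 0 \<and> t n = T \<and> (\<forall>i<n. t i < t (Suc i))"

definition time_step :: "(nat \<Rightarrow> real) \<Rightarrow> nat \<Rightarrow> real" where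
  "time_step t i = t (Suc i) - t i"

definition mesh :: "nat \<Rightarrow> (nat \<Rightarrow> real) \<Rightarrow> real" where
  "mesh n t = (MAX i\<in>{..<n}. time_step t i)"

text \<open>
  Below, \<open>\<F>\<close> is a filtration, \<open>H\<close> the family of coefficients $H_i$, and \<open>lam\<close>, \<open>Lam\<close> are the
  bounds $\lambda$, $\Lambda$. Membership of $H_i$ in $L^2$ expresses that the second moment
  matrix exists.
\<close>

definition scheme_coefficients ::
    "'a measure \<Rightarrow> (real \<Rightarrow> 'a measure) \<Rightarrow> nat \<Rightarrow> (nat \<Rightarrow> real) \<Rightarrow> real \<Rightarrow> real \<Rightarrow> (nat \<Rightarrow> real) \<Rightarrow>
     (nat \<Rightarrow> 'a \<Rightarrow> real^'d) \<Rightarrow> bool" where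
  "scheme_coefficients M \<F> n t lam Lam c H \<longleftrightarrow>
     0 < lam \<and> 0 < Lam \<and>
     prob_space.indep_vars M (\<lambda>_. borel) H {..<n} \<and>
     (\<forall>i<n.
        H i \<in> L2 M (\<F> (t (Suc i))) \<and>
        (AE \<omega> in M. cond_exp M (\<F> (t i)) (H i) \<omega> = 0) \<and>
        mat (c i) = time_step t i *\<^sub>R (\<integral>\<omega>. outer_product (H i \<omega>) (H i \<omega>) \<partial>M) \<and>
        (AE \<omega> in M. mat (c i) =
           time_step t i *\<^sub>R cond_exp M (\<F> (t i)) (\<lambda>\<omega>'. outer_product (H i \<omega>') (H i \<omega>')) \<omega>) \<and>
        lam / real CARD('d) \<le> c i \<and> c i \<le> Lam / real CARD('d))"

text \<open>
  \<open>(Y, Z)\<close> solves the scheme with driver \<open>G\<close> and terminal value \<open>\<xi>\<close>. The equation for $Y_i$ is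
  implicit. Integrability of $G_i(Y_i, Z_i)$ is what makes its conditional expectation meaningful:
  \<^const>\<open>real_cond_exp\<close> is a total function and carries no such meaning otherwise.
\<close>

definition scheme_solution ::
    "'a measure \<Rightarrow> (real \<Rightarrow> 'a measure) \<Rightarrow> nat \<Rightarrow> (nat \<Rightarrow> real) \<Rightarrow> (nat \<Rightarrow> 'a \<Rightarrow> real^'d) \<Rightarrow>
     (nat \<Rightarrow> 'a \<Rightarrow> real \<Rightarrow> real^'d \<Rightarrow> real) \<Rightarrow> ('a \<Rightarrow> real) \<Rightarrow>
     (nat \<Rightarrow> 'a \<Rightarrow> real) \<Rightarrow> (nat \<Rightarrow> 'a \<Rightarrow> real^'d) \<Rightarrow> bool" where
  "scheme_solution M \<F> n t H G \<xi> Y Z \<longleftrightarrow>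
     \<xi> \<in> L2 M (\<F> (t n)) \<and>
     (\<forall>i\<le>n. Y i \<in> L2 M (\<F> (t i)) \<and> Z i \<in> L2 M (\<F> (t i))) \<and>
     (AE \<omega> in M. Y n \<omega> = \<xi> \<omega>) \<and>
     (AE \<omega> in M. Z n \<omega> = 0) \<and>
     (\<forall>i<n.
        integrable M (\<lambda>\<omega>. G i \<omega> (Y i \<omega>) (Z i \<omega>)) \<and>
        (AE \<omega> in M. Y i \<omega> =
           cond_exp M (\<F> (t i))
             (\<lambda>\<omega>'. Y (Suc i) \<omega>' + time_step t i * G i \<omega>' (Y i \<omega>') (Z i \<omega>')) \<omega>) \<and>
        (AE \<omega> in M. Z i \<omega> = cond_exp M (\<F> (t i)) (\<lambda>\<omega>'. Y (Suc i) \<omega>' *\<^sub>R H i \<omega>') \<omega>))"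

text \<open>
  The Lipschitz bound holds outside a single null set, simultaneously in all arguments.
\<close>

definition lipschitz_driver ::
    "'a measure \<Rightarrow> (real \<Rightarrow> 'a measure) \<Rightarrow> nat \<Rightarrow> (nat \<Rightarrow> real) \<Rightarrow> real \<Rightarrow> real \<Rightarrow>
     (nat \<Rightarrow> 'a \<Rightarrow> real \<Rightarrow> real^'d \<Rightarrow> real) \<Rightarrow> bool" where
  "lipschitz_driver M \<F> n t Ky Kz G \<longleftrightarrow>
     0 < Ky \<and> 0 < Kz \<and>
     (\<forall>i<n.
        (\<lambda>(\<omega>, y, z). G i \<omega> y z) \<in> borel_measurable (\<F> (t i) \<Otimes>\<^sub>M borel \<Otimes>\<^sub>M borel) \<and>
        (\<lambda>\<omega>. G i \<omega> 0 0) \<in> L2 M (\<F> (t i)) \<and>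
        (AE \<omega> in M. \<forall>y y' z z'.
           \<bar>G i \<omega> y z - G i \<omega> y' z'\<bar> \<le> Ky * \<bar>y - y'\<bar> + Kz * norm (z - z')))"

end

theory Submission
  imports Defs
begin

text \<open>
  Backward induction. Write $\delta Y = Y^1 - Y^2$ and $\delta Z = Z^1 - Z^2$. If
  $\delta Y_{i+1} \ge 0$, then $|\delta Z_i| \le E_i[\delta Y_{i+1} |H_i|]$, so the smallness of
  $h_i |H_i| K_z$ gives $h_i K_z |\delta Z_i| \le E_i[\delta Y_{i+1}]$. The loss coming from the
  $z$-dependence of the driver is thus absorbed by $E_i[\delta Y_{i+1}]$, leaving
  $\delta Y_i \ge - h_i K_y |\delta Y_i|$, which forces $\delta Y_i \ge 0$ because $h_i K_y < 1$.
\<close>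

section \<open>Vector-valued conditional expectation\<close>

context sigma_finite_subalgebra
begin

lemma borel_measurable_cond_exp [measurable]: "cond_exp M F X \<in> borel_measurable F"
  unfolding cond_exp_def by measurable

lemma cond_exp_diff:
  fixes X Y :: "'a \<Rightarrow> 'b::euclidean_space"
  assumes "integrable M X" and "integrable M Y"
  shows "AE \<omega> in M. cond_exp M F (\<lambda>\<omega>. X \<omega> - Y \<omega>) \<omega> = cond_exp M F X \<omega> - cond_exp M F Y \<omega>"
proof -
  have "AE \<omega> in M. \<forall>b\<in>Basis. real_cond_exp M F (\<lambda>\<omega>. X \<omega> \<bullet> b - Y \<omega> \<bullet> b) \<omega> =
      real_cond_exp M F (\<lambda>\<omega>. X \<omega> \<bullet> b) \<omega> - real_cond_exp M F (\<lambda>\<omega>. Y \<omega> \<bullet> b) \<omega>"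
    by (intro AE_finite_allI finite_Basis real_cond_exp_diff integrable_inner_left assms)
  then show ?thesis
    by (rule eventually_mono)
      (simp add: cond_exp_def inner_diff_left scaleR_diff_left sum_subtractf)
qed

text \<open>
  The norm of the conditional expectation is linearised by pairing it with its own direction, which
  is measurable with respect to \<open>F\<close> and can be moved inside.
\<close>

lemma norm_cond_exp_le:
  fixes X :: "'a \<Rightarrow> 'b::euclidean_space"
  assumes X: "integrable M X"
  shows "AE \<omega> in M. norm (cond_exp M F X \<omega>) \<le> real_cond_exp M F (\<lambda>\<omega>. norm (X \<omega>)) \<omega>"
proof -
  \<comment> \<open>Since \<open>sgn 0 = 0\<close>, this direction exists everywhere with norm at
    most 1, and its pairing with the conditional expectation gives the norm even where that
    vanishes.\<close>
  define A where "A \<omega> = sgn (cond_exp M F X \<omega>)" for \<omega>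
  have A_F [measurable]: "A \<in> borel_measurable F"
    unfolding A_def sgn_div_norm by measurable
  have A_M [measurable]: "A \<in> borel_measurable M"
    using A_F by (rule measurable_from_subalg[OF subalg])
  have X_M [measurable]: "X \<in> borel_measurable M"
    using X by simp
  have norm_A: "norm (A \<omega>) \<le> 1" for \<omega>
    by (simp add: A_def norm_sgn)
  \<comment> \<open>Pulling \<open>A \<omega> \<bullet> b\<close> out of a conditional expectation
    requires an integrable product; two Cauchy-Schwarz bounds dominate it by a multiple of
    \<open>norm (X \<omega>)\<close>.\<close>
  have int: "integrable M (\<lambda>\<omega>. (A \<omega> \<bullet> b) * (X \<omega> \<bullet> b))" for b
  proof (rule Bochner_Integration.integrable_bound)
    show "integrable M (\<lambda>\<omega>. norm b * (norm (X \<omega>) * norm b))"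
      using X by simp
    have "\<bar>A \<omega> \<bullet> b\<bar> \<le> norm b" for \<omega>
      using Cauchy_Schwarz_ineq2[of "A \<omega>" b] mult_right_mono[OF norm_A[of \<omega>] norm_ge_zero[of b]]
      by simp
    then have "\<bar>A \<omega> \<bullet> b\<bar> * \<bar>X \<omega> \<bullet> b\<bar> \<le> norm b * (norm (X \<omega>) * norm b)" for \<omega>
      by (intro mult_mono Cauchy_Schwarz_ineq2) auto
    then show "AE \<omega> in M. norm ((A \<omega> \<bullet> b) * (X \<omega> \<bullet> b)) \<le> norm (norm b * (norm (X \<omega>) * norm b))"
      by (simp add: abs_mult)
  qed measurable
  \<comment> \<open>The pull-out rule is scalar, so the pairing is treated coordinatewise;
    finiteness of the basis leaves a single null set.\<close>
  have "AE \<omega> in M. \<forall>b\<in>Basis. real_cond_exp M F (\<lambda>\<omega>. (A \<omega> \<bullet> b) * (X \<omega> \<bullet> b)) \<omega> =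
      (A \<omega> \<bullet> b) * real_cond_exp M F (\<lambda>\<omega>. X \<omega> \<bullet> b) \<omega>"
    by (intro AE_finite_allI finite_Basis real_cond_exp_mult int) measurable
  moreover have "AE \<omega> in M. real_cond_exp M F (\<lambda>\<omega>. \<Sum>b\<in>Basis. (A \<omega> \<bullet> b) * (X \<omega> \<bullet> b)) \<omega> =
      (\<Sum>b\<in>Basis. real_cond_exp M F (\<lambda>\<omega>. (A \<omega> \<bullet> b) * (X \<omega> \<bullet> b)) \<omega>)"
    by (rule real_cond_exp_sum) (rule int)
  moreover have "AE \<omega> in M. real_cond_exp M F (\<lambda>\<omega>. \<Sum>b\<in>Basis. (A \<omega> \<bullet> b) * (X \<omega> \<bullet> b)) \<omega>
      \<le> real_cond_exp M F (\<lambda>\<omega>. norm (X \<omega>)) \<omega>"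
  proof (rule real_cond_exp_mono)
    have "(\<Sum>b\<in>Basis. (A \<omega> \<bullet> b) * (X \<omega> \<bullet> b)) \<le> norm (X \<omega>)" for \<omega>
    proof -
      have "A \<omega> \<bullet> X \<omega> \<le> norm (A \<omega>) * norm (X \<omega>)"
        by (rule norm_cauchy_schwarz)
      also have "\<dots> \<le> norm (X \<omega>)"
        using norm_A by (simp add: mult_left_le_one_le)
      finally show ?thesis
        by (simp add: euclidean_inner[of "A \<omega>" "X \<omega>"])
    qed
    then show "AE \<omega> in M. (\<Sum>b\<in>Basis. (A \<omega> \<bullet> b) * (X \<omega> \<bullet> b)) \<le> norm (X \<omega>)"
      by simp
  qed (use X int in auto)
  ultimately show ?thesis
  proof eventually_elim
    case (elim \<omega>)
    have "norm (cond_exp M F X \<omega>) = A \<omega> \<bullet> cond_exp M F X \<omega>"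
      by (cases "cond_exp M F X \<omega> = 0")
        (simp_all add: A_def sgn_div_norm dot_square_norm power2_eq_square)
    also have "\<dots> = (\<Sum>b\<in>Basis. (A \<omega> \<bullet> b) * real_cond_exp M F (\<lambda>\<omega>. X \<omega> \<bullet> b) \<omega>)"
      by (simp add: cond_exp_def inner_sum_right mult.commute)
    finally show ?case
      using elim by simp
  qed
qed

end

section \<open>Integrability\<close>

lemma (in finite_measure) integrable_L2:
  fixes X :: "'a \<Rightarrow> 'b::euclidean_space"
  assumes "X \<in> L2 M F" and "subalgebra M F"
  shows "integrable M X"
proof -
  have "X \<in> borel_measurable M"
    using assms(1) by (simp add: L2_def measurable_from_subalg[OF assms(2)])
  then have "integrable M (\<lambda>\<omega>. norm (X \<omega>))"
    using assms(1) by - (rule square_integrable_imp_integrable, simp_all add: L2_def)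
  then show ?thesis
    using \<open>X \<in> borel_measurable M\<close> by (simp only: integrable_norm_iff)
qed

text \<open>The smallness condition makes each coefficient $H_i$ essentially bounded, so this covers
  the products $Y_{i+1} H_i$ and their difference.\<close>

lemma integrable_scaleR_bounded:
  fixes X :: "'a \<Rightarrow> real" and H :: "'a \<Rightarrow> 'b::euclidean_space"
  assumes "integrable M X" and "H \<in> borel_measurable M" and "AE \<omega> in M. norm (H \<omega>) \<le> B"
  shows "integrable M (\<lambda>\<omega>. X \<omega> *\<^sub>R H \<omega>)"
proof (rule Bochner_Integration.integrable_bound)
  show "integrable M (\<lambda>\<omega>. B * X \<omega>)"
    using assms by simp
  show "AE \<omega> in M. norm (X \<omega> *\<^sub>R H \<omega>) \<le> norm (B * X \<omega>)"
    using assms(3)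
  proof eventually_elim
    case (elim \<omega>)
    then have "\<bar>X \<omega>\<bar> * norm (H \<omega>) \<le> \<bar>X \<omega>\<bar> * \<bar>B\<bar>"
      by (intro mult_left_mono) auto
    then show ?case
      by (simp add: abs_mult mult.commute)
  qed
qed (use assms in measurable)

section \<open>Comparison over one time step\<close>

text \<open>Here \<open>U\<close>, \<open>U'\<close> are the solutions at the later time and \<open>V\<close>, \<open>V'\<close> those at the earlier one.\<close>

lemma (in sigma_finite_subalgebra) scheme_step_comparison:
  fixes U U' V V' f f' :: "'a \<Rightarrow> real" and Z Z' H :: "'a \<Rightarrow> 'b::euclidean_space"
  assumes U: "integrable M U" and U': "integrable M U'"
    and V: "integrable M V" "V \<in> borel_measurable F"
    and V': "integrable M V'" "V' \<in> borel_measurable F"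
    and Z: "integrable M Z" "Z \<in> borel_measurable F"
    and Z': "integrable M Z'" "Z' \<in> borel_measurable F"
    and f: "integrable M f" and f': "integrable M f'"
    and H: "H \<in> borel_measurable M"
    and h: "0 < h" "h * Ky < 1" and Kz: "0 < Kz"
    and small: "AE \<omega> in M. h * norm (H \<omega>) * Kz \<le> 1"
    and V_eq: "AE \<omega> in M. V \<omega> = cond_exp M F (\<lambda>\<omega>. U \<omega> + h * f \<omega>) \<omega>"
    and V'_eq: "AE \<omega> in M. V' \<omega> = cond_exp M F (\<lambda>\<omega>. U' \<omega> + h * f' \<omega>) \<omega>"
    and Z_eq: "AE \<omega> in M. Z \<omega> = cond_exp M F (\<lambda>\<omega>. U \<omega> *\<^sub>R H \<omega>) \<omega>"
    and Z'_eq: "AE \<omega> in M. Z' \<omega> = cond_exp M F (\<lambda>\<omega>. U' \<omega> *\<^sub>R H \<omega>) \<omega>"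
    and drivers: "AE \<omega> in M. - Ky * \<bar>V \<omega> - V' \<omega>\<bar> - Kz * norm (Z \<omega> - Z' \<omega>) \<le> f \<omega> - f' \<omega>"
    and le: "AE \<omega> in M. U' \<omega> \<le> U \<omega>"
  shows "AE \<omega> in M. V' \<omega> \<le> V \<omega>"
proof -
  define D where "D \<omega> = U \<omega> - U' \<omega>" for \<omega>
  \<comment> \<open>A lower bound for \<open>h * (f \<omega> - f' \<omega>)\<close>. Only
    integrability is assumed of \<open>f\<close> and \<open>f'\<close>, while \<open>R\<close> is
    measurable with respect to \<open>F\<close> and hence fixed by conditioning.\<close>
  define R where "R \<omega> = h * (- Ky * \<bar>V \<omega> - V' \<omega>\<bar> - Kz * norm (Z \<omega> - Z' \<omega>))" for \<omega>
  have D: "integrable M D"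
    unfolding D_def using U U' by simp
  have R: "integrable M R"
    unfolding R_def using V V' Z Z' by (intro integrable_mult_right Bochner_Integration.integrable_diff) auto
  have R_F: "R \<in> borel_measurable F"
    unfolding R_def using V(2) V'(2) Z(2) Z'(2) by measurable
  have H_bound: "AE \<omega> in M. norm (H \<omega>) \<le> 1 / (h * Kz)"
    using small by eventually_elim (use h Kz in \<open>simp add: field_simps\<close>)
  note int_H = integrable_scaleR_bounded[OF _ H H_bound]

  have Z_bound: "AE \<omega> in M. h * Kz * norm (Z \<omega> - Z' \<omega>) \<le> real_cond_exp M F D \<omega>"
  proof -
    \<comment> \<open>Here \<open>le\<close> is essential: with \<open>D\<close> nonnegative, the
      norm of \<open>D \<omega> *\<^sub>R H \<omega>\<close> is
      \<open>D \<omega> * norm (H \<omega>)\<close>, and \<open>small\<close> may be multiplied by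
      \<open>D \<omega>\<close>.\<close>
    have "AE \<omega> in M. real_cond_exp M F (\<lambda>\<omega>. h * Kz * norm (D \<omega> *\<^sub>R H \<omega>)) \<omega> \<le> real_cond_exp M F D \<omega>"
    proof (rule real_cond_exp_mono)
      show "AE \<omega> in M. h * Kz * norm (D \<omega> *\<^sub>R H \<omega>) \<le> D \<omega>"
        using small le
      proof eventually_elim
        case (elim \<omega>)
        then have "D \<omega> * (h * norm (H \<omega>) * Kz) \<le> D \<omega> * 1"
          by (intro mult_left_mono) (auto simp: D_def)
        with elim show ?case
          by (simp add: D_def mult_ac)
      qed
    qed (intro D int_H integrable_mult_right integrable_norm)+
    moreover have "AE \<omega> in M. real_cond_exp M F (\<lambda>\<omega>. h * Kz * norm (D \<omega> *\<^sub>R H \<omega>)) \<omega> =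
        h * Kz * real_cond_exp M F (\<lambda>\<omega>. norm (D \<omega> *\<^sub>R H \<omega>)) \<omega>"
      by (rule real_cond_exp_cmult) (use int_H[OF D] in \<open>rule integrable_norm\<close>)
    moreover note norm_cond_exp_le[OF int_H[OF D]] cond_exp_diff[OF int_H[OF U] int_H[OF U']] Z_eq Z'_eq
    ultimately show ?thesis
    proof eventually_elim
      case (elim \<omega>)
      \<comment> \<open>By linearity \<open>Z - Z'\<close> is the conditional expectation of
        \<open>D\<close> times \<open>H\<close>.\<close>
      then have "norm (Z \<omega> - Z' \<omega>) \<le> real_cond_exp M F (\<lambda>\<omega>. norm (D \<omega> *\<^sub>R H \<omega>)) \<omega>"
        by (simp add: D_def scaleR_diff_left)
      then have "h * Kz * norm (Z \<omega> - Z' \<omega>) \<le>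
          h * Kz * real_cond_exp M F (\<lambda>\<omega>. norm (D \<omega> *\<^sub>R H \<omega>)) \<omega>"
        using h Kz by (intro mult_left_mono) auto
      with elim show ?case
        by linarith
    qed
  qed
  have "AE \<omega> in M. real_cond_exp M F (\<lambda>\<omega>. D \<omega> + R \<omega>) \<omega> \<le>
      real_cond_exp M F (\<lambda>\<omega>. (U \<omega> + h * f \<omega>) - (U' \<omega> + h * f' \<omega>)) \<omega>"
  proof (rule real_cond_exp_mono)
    show "AE \<omega> in M. D \<omega> + R \<omega> \<le> (U \<omega> + h * f \<omega>) - (U' \<omega> + h * f' \<omega>)"
      using drivers
    proof eventually_elim
      case (elim \<omega>)
      then have "R \<omega> \<le> h * (f \<omega> - f' \<omega>)"
        unfolding R_def using h by (intro mult_left_mono) auto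
      then show ?case
        by (simp add: D_def algebra_simps)
    qed
  qed (use D R U U' f f' in auto)
  moreover have "AE \<omega> in M. real_cond_exp M F (\<lambda>\<omega>. (U \<omega> + h * f \<omega>) - (U' \<omega> + h * f' \<omega>)) \<omega> =
      real_cond_exp M F (\<lambda>\<omega>. U \<omega> + h * f \<omega>) \<omega> - real_cond_exp M F (\<lambda>\<omega>. U' \<omega> + h * f' \<omega>) \<omega>"
    using U U' f f' by (intro real_cond_exp_diff) auto
  moreover note real_cond_exp_add[OF D R] real_cond_exp_F_meas[OF R R_F]
    V_eq[unfolded cond_exp_real] V'_eq[unfolded cond_exp_real] Z_bound
  ultimately show ?thesis
  proof eventually_elim
    case (elim \<omega>)
    \<comment> \<open>\<open>V - V'\<close> dominates the conditional expectation of
      \<open>D\<close> plus \<open>R\<close>. By \<open>Z_bound\<close> the former is at least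
      \<open>h * Kz * norm (Z \<omega> - Z' \<omega>)\<close>, which cancels the
      \<open>z\<close>-part of \<open>R\<close>.\<close>
    then have *: "- (h * Ky) * \<bar>V \<omega> - V' \<omega>\<bar> \<le> V \<omega> - V' \<omega>"
      by (simp add: R_def algebra_simps)
    show ?case
    proof (rule ccontr)
      assume neg: "\<not> V' \<omega> \<le> V \<omega>"
      \<comment> \<open>Under \<open>neg\<close> the gap \<open>V' \<omega> - V \<omega>\<close> is
        positive and by \<open>*\<close> at most \<open>h * Ky\<close> times itself, which is
        impossible as \<open>h * Ky < 1\<close>.\<close>
      then have "(h * Ky) * (V' \<omega> - V \<omega>) < 1 * (V' \<omega> - V \<omega>)"
        using h by (intro mult_strict_right_mono) auto
      moreover have "\<bar>V \<omega> - V' \<omega>\<bar> = V' \<omega> - V \<omega>"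
        using neg by simp
      ultimately show False
        using * by simp
    qed
  qed
qed

section \<open>Backward induction along the grid\<close>

theorem corollary2p5:
  fixes M :: "'a measure"
    and W :: "real \<Rightarrow> 'a \<Rightarrow> real^'d"
    and T :: real and n :: nat and t :: "nat \<Rightarrow> real"
    and lam Lam :: real and c :: "nat \<Rightarrow> real"
    and H :: "nat \<Rightarrow> 'a \<Rightarrow> real^'d"
    and F1 F2 :: "nat \<Rightarrow> 'a \<Rightarrow> real \<Rightarrow> real^'d \<Rightarrow> real"
    and \<xi>1 \<xi>2 :: "'a \<Rightarrow> real"
    and Y1 Y2 :: "nat \<Rightarrow> 'a \<Rightarrow> real"
    and Z1 Z2 :: "nat \<Rightarrow> 'a \<Rightarrow> real^'d"
    and Ky Kz \<epsilon> :: real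
  defines "\<F> \<equiv> brownian_filtration M W"
  assumes "brownian_motion M T W"
    and "time_grid T n t"
    and "scheme_coefficients M \<F> n t lam Lam c H"
    and "scheme_solution M \<F> n t H F1 \<xi>1 Y1 Z1"
    and "scheme_solution M \<F> n t H F2 \<xi>2 Y2 Z2"
    and "lipschitz_driver M \<F> n t Ky Kz F1"
    and "0 < \<epsilon>" and "\<epsilon> < 1" and "mesh n t * Ky < 1 - \<epsilon>"
    and "AE \<omega> in M. (SUP i\<in>{..<n}. time_step t i * norm (H i \<omega>)) * Kz < 1"
    and "AE \<omega> in M. Y1 n \<omega> \<ge> Y2 n \<omega>"
    and "\<forall>i<n. AE \<omega> in M. F1 i \<omega> (Y2 i \<omega>) (Z2 i \<omega>) \<ge> F2 i \<omega> (Y2 i \<omega>) (Z2 i \<omega>)"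
  shows "\<forall>i\<le>n. AE \<omega> in M. Y1 i \<omega> \<ge> Y2 i \<omega>"
proof -
  interpret prob_space M
    using \<open>brownian_motion M T W\<close> by (simp add: brownian_motion_def)
  note grid = \<open>time_grid T n t\<close>
  have step: "0 < time_step t i" if "i < n" for i
    using grid that by (simp add: time_grid_def time_step_def)
  \<comment> \<open>\<open>W\<close> is known to be measurable only up to time \<open>T\<close>, so
    the filtration is known to lie in \<open>M\<close> only up to there; the bound descends from
    \<open>t n = T\<close>.\<close>
  have t_le: "t i \<le> T" if "i \<le> n" for i
    using that
  proof (induction i rule: inc_induct)
    case base
    then show ?case
      using grid by (simp add: time_grid_def)
  next
    case (step i)
    then show ?case
      using grid by (force simp: time_grid_def)
  qed
  have sub: "subalgebra M (\<F> (t i))" if "i \<le> n" for i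
    unfolding \<F>_def
    using \<open>brownian_motion M T W\<close> t_le[OF that] by (rule subalgebra_brownian_filtration)

  note sol = \<open>scheme_solution M \<F> n t H F1 \<xi>1 Y1 Z1\<close> \<open>scheme_solution M \<F> n t H F2 \<xi>2 Y2 Z2\<close>
  note lip = \<open>lipschitz_driver M \<F> n t Ky Kz F1\<close>
  have L2_Y: "Y1 i \<in> L2 M (\<F> (t i))" "Y2 i \<in> L2 M (\<F> (t i))"
    and L2_Z: "Z1 i \<in> L2 M (\<F> (t i))" "Z2 i \<in> L2 M (\<F> (t i))" if "i \<le> n" for i
    using sol that by (auto simp: scheme_solution_def)
  have pos: "0 < Ky" "0 < Kz"
    using lip by (auto simp: lipschitz_driver_def)

  show ?thesis
  proof (intro allI impI)
    fix i assume "i \<le> n"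
    then show "AE \<omega> in M. Y1 i \<omega> \<ge> Y2 i \<omega>"
    proof (induction i rule: inc_induct)
      case base
      show ?case by fact
    next
      case (step i)
      then have i: "i < n" and Suc_i: "Suc i \<le> n" and i': "i \<le> n"
        by auto
      interpret finite_measure_subalgebra M "\<F> (t i)"
        by standard (rule sub[OF i'])
      \<comment> \<open>\<open>H i\<close> is measurable at the later time \<open>t (Suc i)\<close>,
        which is still a grid point because \<open>i < n\<close>.\<close>
      have H: "H i \<in> borel_measurable M"
        using \<open>scheme_coefficients M \<F> n t lam Lam c H\<close> i
        by (simp add: scheme_coefficients_def L2_def measurable_from_subalg[OF sub[OF Suc_i]])
      have "time_step t i \<le> mesh n t"
        unfolding mesh_def using i by (intro Max_ge) auto
      then have "time_step t i * Ky \<le> mesh n t * Ky"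
        using pos by simp
      then have hKy: "time_step t i * Ky < 1"
        using \<open>mesh n t * Ky < 1 - \<epsilon>\<close> \<open>0 < \<epsilon>\<close> by linarith
      have small: "AE \<omega> in M. time_step t i * norm (H i \<omega>) * Kz \<le> 1"
        using \<open>AE \<omega> in M. (SUP i\<in>{..<n}. time_step t i * norm (H i \<omega>)) * Kz < 1\<close>
      proof eventually_elim
        case (elim \<omega>)
        \<comment> \<open>The supremum runs over a finite set, so it is a genuine upper bound for
          every path.\<close>
        have "time_step t i * norm (H i \<omega>) \<le> (SUP i\<in>{..<n}. time_step t i * norm (H i \<omega>))"
          using i by (intro cSUP_upper bdd_above_finite) auto
        then have "time_step t i * norm (H i \<omega>) * Kz \<le>
            (SUP i\<in>{..<n}. time_step t i * norm (H i \<omega>)) * Kz"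
          using pos by (intro mult_right_mono) auto
        with elim show ?case
          by linarith
      qed
      \<comment> \<open>One null set serves all arguments, so the random points given by both
        solutions can be inserted path by path.\<close>
      have "AE \<omega> in M. \<forall>y y' z z'.
          \<bar>F1 i \<omega> y z - F1 i \<omega> y' z'\<bar> \<le> Ky * \<bar>y - y'\<bar> + Kz * norm (z - z')"
        using lip i by (auto simp: lipschitz_driver_def)
      moreover have "AE \<omega> in M. F1 i \<omega> (Y2 i \<omega>) (Z2 i \<omega>) \<ge> F2 i \<omega> (Y2 i \<omega>) (Z2 i \<omega>)"
        using i \<open>\<forall>i<n. AE \<omega> in M. F1 i \<omega> (Y2 i \<omega>) (Z2 i \<omega>) \<ge> F2 i \<omega> (Y2 i \<omega>) (Z2 i \<omega>)\<close>
        by blast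
      \<comment> \<open>Insert \<open>F1\<close> at the second solution: the Lipschitz bound
        controls the change of arguments, and the remaining difference of drivers is
        nonnegative.\<close>
      ultimately have drivers: "AE \<omega> in M. - Ky * \<bar>Y1 i \<omega> - Y2 i \<omega>\<bar> - Kz * norm (Z1 i \<omega> - Z2 i \<omega>)
          \<le> F1 i \<omega> (Y1 i \<omega>) (Z1 i \<omega>) - F2 i \<omega> (Y2 i \<omega>) (Z2 i \<omega>)"
      proof eventually_elim
        case (elim \<omega>)
        then have "\<bar>F1 i \<omega> (Y1 i \<omega>) (Z1 i \<omega>) - F1 i \<omega> (Y2 i \<omega>) (Z2 i \<omega>)\<bar>
            \<le> Ky * \<bar>Y1 i \<omega> - Y2 i \<omega>\<bar> + Kz * norm (Z1 i \<omega> - Z2 i \<omega>)"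
          by blast
        with elim show ?case
          by linarith
      qed
      show ?case
      proof (rule scheme_step_comparison[where U = "Y1 (Suc i)" and U' = "Y2 (Suc i)" and H = "H i"
            and h = "time_step t i" and Ky = Ky and Kz = Kz and Z = "Z1 i" and Z' = "Z2 i"
            and f = "\<lambda>\<omega>. F1 i \<omega> (Y1 i \<omega>) (Z1 i \<omega>)" and f' = "\<lambda>\<omega>. F2 i \<omega> (Y2 i \<omega>) (Z2 i \<omega>)"])
        show "integrable M (Y1 (Suc i))" "integrable M (Y2 (Suc i))"
          using L2_Y[OF Suc_i] sub[OF Suc_i] by (auto intro: integrable_L2)
        show "integrable M (Y1 i)" "integrable M (Y2 i)" "integrable M (Z1 i)" "integrable M (Z2 i)"
          using L2_Y[OF i'] L2_Z[OF i'] sub[OF i'] by (auto intro: integrable_L2)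
        show "Y1 i \<in> borel_measurable (\<F> (t i))" "Y2 i \<in> borel_measurable (\<F> (t i))"
          "Z1 i \<in> borel_measurable (\<F> (t i))" "Z2 i \<in> borel_measurable (\<F> (t i))"
          using L2_Y[OF i'] L2_Z[OF i'] by (auto simp: L2_def)
      \<comment> \<open>\<open>step(3)\<close> is the comparison at \<open>Suc i\<close>, which
        discharges \<open>le\<close>.\<close>
      qed (use sol i H step(3) \<open>0 < Kz\<close> hKy small drivers \<open>\<And>i. i < n \<Longrightarrow> 0 < time_step t i\<close>
          in \<open>auto simp: scheme_solution_def\<close>)
    qed
  qed
qed

end
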